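(* The ideal $\mathcal L$ on $\omega$ generated by lacunary sets is not $\le_K$-homogeneous (in particular, it is not homogeneous).
   Context: An ideal on a set $X$ is a family of subsets of $X$ closed under finite unions and subsets, containing all finite subsets of $X$ and not containing $X$; $\mathcal I^+=\mathcal P(X)\setminus\mathcal I$. A set $A\subseteq\omega$ is lacunary if $\lim_{n}(a_{n+1}-a_n)=\infty$, where $(a_n)$ is the increasing enumeration of $A$; $\mathcal L$ consists of all subsets of finite unions of lacunary sets (and finite sets). For ideals $\mathcal I$ on $X$ and $\mathcal K$ on $Y$, $\mathcal I\le_K\mathcal K$ (Katětov order) means that there is $f:Y\to X$ with $f^{-1}[B]\in\mathcal K$ for all $B\in\mathcal I$; $\mathcal I$ and $\mathcal K$ are isomorphic if there is a bijection $f:Y\to X$ with $f^{-1}[B]\in\mathcal K\iff B\in\mathcal I$. For $A\in\mathcal I^+$, $\mathcal I\restriction A=\{B\cap A:B\in\mathcal I\}$ (an ideal on $A$). $\mathcal I$ is homogeneous if $\mathcal I\restriction A$ is isomorphic to $\mathcal I$ for each $A\in\mathcal I^+$, and $\le_K$-homogeneous if $\mathcal I\restriction A\le_K\mathcal I$ and $\mathcal I\le_K\mathcal I\restriction A$ for each $A\in\mathcal I^+$. *)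

theory Defs
  imports Complex_Main "HOL-Library.Infinite_Set" "HOL-Library.FuncSet"
begin

definition ideal_on :: "'a set \<Rightarrow> 'a set set \<Rightarrow> bool" where
  "ideal_on X I \<longleftrightarrow>
     I \<subseteq> Pow X \<and>
     (\<forall>A\<in>I. \<forall>B\<in>I. A \<union> B \<in> I) \<and>
     (\<forall>A\<in>I. \<forall>B. B \<subseteq> A \<longrightarrow> B \<in> I) \<and>
     (\<forall>F. F \<subseteq> X \<and> finite F \<longrightarrow> F \<in> I) \<and>
     X \<notin> I"

definition positive_sets :: "'a set \<Rightarrow> 'a set set \<Rightarrow> 'a set set" where
  "positive_sets X I = Pow X - I"

definition restrict_ideal :: "'a set set \<Rightarrow> 'a set \<Rightarrow> 'a set set" where
  "restrict_ideal I A = {B \<inter> A |B. B \<in> I}"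

text \<open>The restriction of an ideal to \<open>A\<close> is an ideal on the set \<open>A\<close>, not on a type, so the
  relations below carry the underlying sets: \<open>I\<close> lives on \<open>X\<close> and \<open>K\<close> on \<open>Y\<close>. Preimages
  are cut down to \<open>Y\<close> because \<open>f\<close> is total and its values outside \<open>Y\<close> are irrelevant.\<close>

definition katetov_le :: "'a set \<Rightarrow> 'a set set \<Rightarrow> 'b set \<Rightarrow> 'b set set \<Rightarrow> bool" where
  "katetov_le X I Y K \<longleftrightarrow> (\<exists>f. f \<in> Y \<rightarrow> X \<and> (\<forall>B\<in>I. f -` B \<inter> Y \<in> K))"

definition ideal_isomorphic :: "'a set \<Rightarrow> 'a set set \<Rightarrow> 'b set \<Rightarrow> 'b set set \<Rightarrow> bool" where
  "ideal_isomorphic X I Y K \<longleftrightarrow>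
     (\<exists>f. bij_betw f Y X \<and> (\<forall>B. B \<subseteq> X \<longrightarrow> (f -` B \<inter> Y \<in> K \<longleftrightarrow> B \<in> I)))"

definition homogeneous :: "'a set \<Rightarrow> 'a set set \<Rightarrow> bool" where
  "homogeneous X I \<longleftrightarrow>
     (\<forall>A\<in>positive_sets X I. ideal_isomorphic A (restrict_ideal I A) X I)"

definition katetov_homogeneous :: "'a set \<Rightarrow> 'a set set \<Rightarrow> bool" where
  "katetov_homogeneous X I \<longleftrightarrow>
     (\<forall>A\<in>positive_sets X I.
        katetov_le A (restrict_ideal I A) X I \<and> katetov_le X I A (restrict_ideal I A))"

text \<open>The increasing enumeration \<open>(a\<^sub>n)\<close> of \<open>A\<close> is the library's \<open>enumerate A\<close>, which
  is meaningful only for infinite \<open>A\<close>; the subtraction on naturals is then never truncated.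
  Finite sets are not lacunary here and enter the ideal separately.\<close>

definition lacunary :: "nat set \<Rightarrow> bool" where
  "lacunary A \<longleftrightarrow> infinite A \<and>
     filterlim (\<lambda>n. enumerate A (Suc n) - enumerate A n) at_top sequentially"

definition lacunary_ideal :: "nat set set" where
  "lacunary_ideal =
     {B. \<exists>\<A> F. finite \<A> \<and> (\<forall>A\<in>\<A>. lacunary A) \<and> finite F \<and> B \<subseteq> \<Union>\<A> \<union> F}"

lemma lacunary_gap:
  assumes "lacunary A"
  shows "\<exists>N. \<forall>x\<in>A. \<forall>y\<in>A. N \<le> x \<longrightarrow> x < y \<longrightarrow> m < y - x"
proof -
  have inf: "infinite A" using assms by (simp add: lacunary_def)
  have "eventually (\<lambda>n. Suc m \<le> enumerate A (Suc n) - enumerate A n) sequentially"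
    using assms by (simp add: lacunary_def filterlim_at_top)
  then obtain n0 where n0: "\<And>n. n0 \<le> n \<Longrightarrow> Suc m \<le> enumerate A (Suc n) - enumerate A n"
    by (auto simp: eventually_sequentially)
  have "m < y - x" if "x \<in> A" "y \<in> A" "enumerate A n0 \<le> x" "x < y" for x y
  proof -
    obtain i where i: "x = enumerate A i"
      using enumerate_Ex[OF inf \<open>x \<in> A\<close>] by blast
    obtain j where j: "y = enumerate A j"
      using enumerate_Ex[OF inf \<open>y \<in> A\<close>] by blast
    note ij = i j
    have "n0 \<le> i" using that ij inf by simp
    moreover have "enumerate A (Suc i) \<le> y"
      using that ij inf by (simp add: Suc_le_eq)
    ultimately show ?thesis using n0[of i] ij by linarith
  qed
  then show ?thesis by blast
qed

lemma ideal_on_lacunary_ideal: "ideal_on UNIV lacunary_ideal"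
proof -
  have un: "A \<union> B \<in> lacunary_ideal" if "A \<in> lacunary_ideal" "B \<in> lacunary_ideal" for A B
  proof -
    from that obtain \<A> F \<B> G where
      "finite \<A>" "\<forall>A\<in>\<A>. lacunary A" "finite F" "A \<subseteq> \<Union>\<A> \<union> F"
      "finite \<B>" "\<forall>A\<in>\<B>. lacunary A" "finite G" "B \<subseteq> \<Union>\<B> \<union> G"
      by (auto simp: lacunary_ideal_def)
    then have "finite (\<A> \<union> \<B>) \<and> (\<forall>A\<in>\<A> \<union> \<B>. lacunary A) \<and> finite (F \<union> G) \<and>
        A \<union> B \<subseteq> \<Union>(\<A> \<union> \<B>) \<union> (F \<union> G)"
      by auto
    then show ?thesis unfolding lacunary_ideal_def mem_Collect_eq by (intro exI)
  qed
  have fin: "F \<in> lacunary_ideal" if "finite F" for F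
    unfolding lacunary_ideal_def mem_Collect_eq
    by (rule exI[of _ "{}"], rule exI[of _ F]) (simp add: that)
  have proper: "UNIV \<notin> lacunary_ideal"
  proof
    assume "UNIV \<in> lacunary_ideal"
    then obtain \<A> F where h: "finite \<A>" "\<And>A. A \<in> \<A> \<Longrightarrow> lacunary A" "finite F"
        "UNIV = \<Union>\<A> \<union> F"
      by (auto simp: lacunary_ideal_def)
    define k where "k = card \<A>"
    obtain N where N: "\<And>A x y. A \<in> \<A> \<Longrightarrow> x \<in> A \<Longrightarrow> y \<in> A \<Longrightarrow> N A \<le> x \<Longrightarrow> x < y \<Longrightarrow> k < y - x"
      using lacunary_gap[OF h(2), of _ k] by metis
    define M where "M = Suc (Max (insert 0 (N ` \<A> \<union> F)))"
    have MN: "N A \<le> M" if "A \<in> \<A>" for A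
      unfolding M_def using that h by (intro le_SucI Max_ge) auto
    have MF: "x \<notin> F" if "M \<le> x" for x
    proof
      assume "x \<in> F"
      then have "x \<le> Max (insert 0 (N ` \<A> \<union> F))" using h(1,3) by (intro Max_ge) auto
      then show False using that unfolding M_def by linarith
    qed
    have "\<forall>x\<in>{M..M + k}. \<exists>A\<in>\<A>. x \<in> A"
    proof
      fix x assume "x \<in> {M..M + k}"
      then have "x \<notin> F" using MF by simp
      moreover have "x \<in> \<Union>\<A> \<union> F" using h(4) by blast
      ultimately show "\<exists>A\<in>\<A>. x \<in> A" by blast
    qed
    then obtain g where g: "\<And>x. x \<in> {M..M + k} \<Longrightarrow> g x \<in> \<A> \<and> x \<in> g x" by metis
    have "g ` {M..M + k} \<subseteq> \<A>" using g by auto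
    then have "card (g ` {M..M + k}) \<le> k" unfolding k_def by (intro card_mono h(1))
    then have "\<not> inj_on g {M..M + k}" using card_image[of g "{M..M + k}"] by auto
    then obtain x y where xy: "x \<in> {M..M + k}" "y \<in> {M..M + k}" "x < y" "g x = g y"
      unfolding inj_on_def by (metis linorder_neqE_nat)
    have "k < y - x"
      by (rule N[of "g x"]) (use xy g MN[of "g x"] in \<open>auto intro: order_trans\<close>)
    then show False using xy by auto
  qed
  have down: "B \<in> lacunary_ideal" if "A \<in> lacunary_ideal" "B \<subseteq> A" for A B
    using that(1) order_trans[OF that(2)] unfolding lacunary_ideal_def mem_Collect_eq by metis
  show ?thesis
    unfolding ideal_on_def
  proof (intro conjI ballI allI impI)
    show "lacunary_ideal \<subseteq> Pow UNIV" by simp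
    show "UNIV \<notin> lacunary_ideal" by (rule proper)
  qed (use un down fin in simp_all)
qed

end

theory Submission
  imports Defs
begin

text \<open>
  The obstruction is the ideal \<open>Fin \<otimes> Fin\<close> on \<open>\<omega> \<times> \<omega>\<close>, generated by the columns and by the sets that
  meet every column in a finite set: there is a positive set \<open>A\<close> for which it lies
  Katetov-below \<open>\<L> \<restriction> A\<close>, whereas it does not lie Katetov-below \<open>\<L>\<close> itself. Hence
  \<open>\<L> \<restriction> A \<le>\<^sub>K \<L>\<close> is impossible.

  For \<open>A\<close> take the numbers \<open>2 ^ n + 2 ^ j\<close> with \<open>j < n\<close>, split into the columns \<open>A\<^sub>j\<close> of fixed
  \<open>j\<close>. The next element of \<open>A\<close> after \<open>2 ^ n + 2 ^ j\<close> is at distance at least \<open>2 ^ j\<close>. So a subset of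
  \<open>A\<close> that meets every column in a finite set has gaps tending to infinity, and each column is itself
  lacunary. This is what makes \<open>\<L> \<restriction> A\<close> contain a copy of \<open>Fin \<otimes> Fin\<close>. On the other hand \<open>A\<close>
  is positive, because the \<open>K + 1\<close> points \<open>2 ^ n + 2 ^ j\<close> with \<open>j \<le> K\<close> occur, for every large \<open>n\<close>,
  within an interval whose length depends on \<open>K\<close> only.

  On the side of \<open>\<L>\<close>, a set \<open>B\<close> in the ideal has a uniform bound \<open>K\<close> such that every interval of a
  given length contains, if it is far enough out, at most \<open>K\<close> points of \<open>B\<close>
  (\<open>lacunary_ideal_window_bound\<close>). By the pigeonhole principle the complement of \<open>B\<close> therefore
  contains arbitrarily long intervals arbitrarily far out. Given countably many sets \<open>X\<^sub>j\<close> in \<open>\<L>\<close>,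
  let \<open>Z\<close> be the union over \<open>k\<close> of intervals of length \<open>k\<close> that start at or beyond \<open>k\<close> and avoid
  \<open>X\<^sub>0, \<dots>, X\<^sub>k\<close>: it meets each \<open>X\<^sub>j\<close> in a finite set, but as it contains arbitrarily long
  intervals arbitrarily far out, it is not in \<open>\<L>\<close>
  (\<open>positive_set_almost_avoiding\<close>).

  If \<open>f\<close> witnessed \<open>\<L> \<restriction> A \<le>\<^sub>K \<L>\<close>, this could be applied to the preimages \<open>X\<^sub>j\<close> of the columns. The
  image of \<open>Z\<close> would meet every column in a finite set and so lie in \<open>\<L>\<close>; then its preimage, which
  contains \<open>Z\<close>, would lie in \<open>\<L>\<close> as well.
\<close>

section \<open>Criteria for membership in the ideal\<close>

lemma lacunary_ideal_subset: "B \<subseteq> A \<Longrightarrow> A \<in> lacunary_ideal \<Longrightarrow> B \<in> lacunary_ideal"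
  using ideal_on_lacunary_ideal unfolding ideal_on_def by blast

lemma lacunary_ideal_finite: "finite F \<Longrightarrow> F \<in> lacunary_ideal"
  using ideal_on_lacunary_ideal unfolding ideal_on_def by blast

lemma lacunary_ideal_Un: "A \<in> lacunary_ideal \<Longrightarrow> B \<in> lacunary_ideal \<Longrightarrow> A \<union> B \<in> lacunary_ideal"
  using ideal_on_lacunary_ideal unfolding ideal_on_def by blast

lemma lacunary_ideal_finite_UN:
  assumes "finite J" "\<And>j. j \<in> J \<Longrightarrow> X j \<in> lacunary_ideal"
  shows "(\<Union>j\<in>J. X j) \<in> lacunary_ideal"
  using assms by (induction J) (auto intro: lacunary_ideal_finite lacunary_ideal_Un)

text \<open>Gaps may be tested between arbitrary elements in place of consecutive terms of the increasing
  enumeration; this is a converse to \<open>lacunary_gap\<close>.\<close>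

lemma lacunary_idealI_gap:
  assumes gap: "\<And>m. \<exists>N. \<forall>x\<in>B. \<forall>y\<in>B. N \<le> x \<longrightarrow> x < y \<longrightarrow> m < y - x"
  shows "B \<in> lacunary_ideal"
proof (cases "finite B")
  case True
  then show ?thesis by (rule lacunary_ideal_finite)
next
  case False
  have "\<forall>\<^sub>F n in sequentially. m \<le> enumerate B (Suc n) - enumerate B n" for m
  proof -
    obtain N where N: "\<And>x y. x \<in> B \<Longrightarrow> y \<in> B \<Longrightarrow> N \<le> x \<Longrightarrow> x < y \<Longrightarrow> m < y - x"
      using gap by blast
    have "m \<le> enumerate B (Suc n) - enumerate B n" if "N \<le> n" for n
    proof -
      have "N \<le> enumerate B n" using le_enumerate[OF False, of n] that by linarith
      then have "m < enumerate B (Suc n) - enumerate B n"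
        using False by (intro N enumerate_in_set enumerate_step)
      then show ?thesis by simp
    qed
    then show ?thesis by (auto simp: eventually_sequentially)
  qed
  then have "lacunary B" using False by (simp add: lacunary_def filterlim_at_top)
  then show ?thesis
    unfolding lacunary_ideal_def mem_Collect_eq
    by (intro exI[of _ "{B}"] exI[of _ "{}"]) simp
qed

text \<open>The bound is the number of lacunary sets that cover \<open>B\<close>: far enough out, each of them has at
  most one point in an interval of length \<open>m\<close>.\<close>

lemma lacunary_ideal_window_bound:
  assumes "B \<in> lacunary_ideal"
  shows "\<exists>K. \<forall>m. \<exists>N. \<forall>x\<ge>N. card (B \<inter> {x..<x + m}) \<le> K"
proof -
  obtain \<A> F where \<A>: "finite \<A>" "\<And>A. A \<in> \<A> \<Longrightarrow> lacunary A" "finite F" "B \<subseteq> \<Union>\<A> \<union> F"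
    using assms by (auto simp: lacunary_ideal_def)
  have "\<exists>N. \<forall>x\<ge>N. card (B \<inter> {x..<x + m}) \<le> card \<A>" for m
  proof -
    obtain G where G: "\<And>A x y. A \<in> \<A> \<Longrightarrow> x \<in> A \<Longrightarrow> y \<in> A \<Longrightarrow> G A \<le> x \<Longrightarrow> x < y \<Longrightarrow> m < y - x"
      using lacunary_gap[OF \<A>(2), of _ m] by metis
    define N where "N = Suc (Max (insert 0 (G ` \<A> \<union> F)))"
    have GN: "G A \<le> N" if "A \<in> \<A>" for A
      unfolding N_def using that \<A> by (intro le_SucI Max_ge) auto
    have FN: "y < N" if "y \<in> F" for y
      unfolding N_def less_Suc_eq_le using that \<A> by (intro Max_ge) auto
    have "card (B \<inter> {x..<x + m}) \<le> card \<A>" if x: "N \<le> x" for x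
    proof -
      have one: "card (A \<inter> {x..<x + m}) \<le> 1" if A: "A \<in> \<A>" for A
      proof -
        have "\<not> y < z" if "y \<in> A \<inter> {x..<x + m}" "z \<in> A \<inter> {x..<x + m}" for y z
          using G[OF A, of y z] GN[OF A] x that by fastforce
        then have "\<forall>y\<in>A \<inter> {x..<x + m}. \<forall>z\<in>A \<inter> {x..<x + m}. y = z"
          by (meson linorder_neqE_nat)
        then show ?thesis by (simp add: card_le_Suc0_iff_eq)
      qed
      have "B \<inter> {x..<x + m} \<subseteq> (\<Union>A\<in>\<A>. A \<inter> {x..<x + m})"
        using \<A>(4) FN x by fastforce
      then have "card (B \<inter> {x..<x + m}) \<le> card (\<Union>A\<in>\<A>. A \<inter> {x..<x + m})"
        by (intro card_mono) (auto simp: \<A>)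
      also have "\<dots> \<le> (\<Sum>A\<in>\<A>. card (A \<inter> {x..<x + m}))"
        by (intro card_UN_le \<A>)
      also have "\<dots> \<le> (\<Sum>A\<in>\<A>. 1)"
        by (intro sum_mono one)
      finally show ?thesis by simp
    qed
    then show ?thesis by blast
  qed
  then show ?thesis by blast
qed

section \<open>Long intervals outside sets in the ideal\<close>

text \<open>Otherwise all far intervals of length \<open>k\<close> would meet \<open>B\<close>, and \<open>K + 1\<close> consecutive ones would
  together contain more points of \<open>B\<close> than the bound \<open>K\<close> for intervals of length \<open>(K + 1) * k\<close>.\<close>

lemma lacunary_ideal_avoids_interval:
  assumes "B \<in> lacunary_ideal"
  shows "\<exists>x\<ge>N. {x..<x + k} \<inter> B = {}"
proof (rule ccontr)
  assume "\<not> ?thesis"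
  then have meets: "\<exists>y. y \<in> {x..<x + k} \<inter> B" if "N \<le> x" for x
    using that by blast
  obtain K where K: "\<And>m. \<exists>N. \<forall>x\<ge>N. card (B \<inter> {x..<x + m}) \<le> K"
    using lacunary_ideal_window_bound[OF assms] by blast
  obtain M where M: "\<And>x. M \<le> x \<Longrightarrow> card (B \<inter> {x..<x + Suc K * k}) \<le> K"
    using K by blast
  define x where "x = max M N"
  have "\<exists>y. y \<in> {x + i * k..<x + i * k + k} \<inter> B" for i
    by (rule meets) (simp add: x_def)
  then obtain p where p: "\<And>i. p i \<in> {x + i * k..<x + i * k + k} \<inter> B"
    by metis
  have less: "p i < p j" if "i < j" for i j
  proof -
    have "Suc i * k \<le> j * k" using that by (intro mult_le_mono1) simp
    then show ?thesis using p[of i] p[of j] by auto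
  qed
  then have "strict_mono p" by (rule strict_monoI)
  then have "card (p ` {..K}) = Suc K"
    by (simp add: card_image strict_mono_imp_inj_on inj_on_subset)
  moreover have "p ` {..K} \<subseteq> B \<inter> {x..<x + Suc K * k}"
  proof
    fix y assume "y \<in> p ` {..K}"
    then obtain i where i: "i \<le> K" "y = p i" by auto
    have "Suc i * k \<le> Suc K * k" using i by (intro mult_le_mono1) simp
    moreover have "p i \<in> B" "x \<le> p i" "p i < x + Suc i * k" using p[of i] by auto
    ultimately show "y \<in> B \<inter> {x..<x + Suc K * k}"
      unfolding i(2) Int_iff atLeastLessThan_iff by linarith
  qed
  then have "card (p ` {..K}) \<le> card (B \<inter> {x..<x + Suc K * k})"
    by (intro card_mono) auto
  moreover have "\<dots> \<le> K" by (rule M) (simp add: x_def)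
  ultimately show False by linarith
qed

text \<open>This says that \<open>Fin \<otimes> Fin\<close> is not Katetov-below the ideal generated by lacunary sets: think
  of \<open>X j\<close> as the preimage of column \<open>j\<close>.\<close>

lemma positive_set_almost_avoiding:
  fixes X :: "nat \<Rightarrow> nat set"
  assumes "\<And>j. X j \<in> lacunary_ideal"
  shows "\<exists>Z. Z \<notin> lacunary_ideal \<and> (\<forall>j. finite (Z \<inter> X j))"
proof -
  have "\<exists>x\<ge>k. {x..<x + k} \<inter> (\<Union>j\<le>k. X j) = {}" for k
    by (intro lacunary_ideal_avoids_interval lacunary_ideal_finite_UN assms) simp
  then obtain s where s: "\<And>k. k \<le> s k" "\<And>k. {s k..<s k + k} \<inter> (\<Union>j\<le>k. X j) = {}"
    by metis
  define Z where "Z = (\<Union>k. {s k..<s k + k})"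
  have "Z \<notin> lacunary_ideal"
  proof
    assume "Z \<in> lacunary_ideal"
    then obtain K where "\<And>m. \<exists>N. \<forall>x\<ge>N. card (Z \<inter> {x..<x + m}) \<le> K"
      using lacunary_ideal_window_bound by blast
    then obtain N where N: "\<And>x. N \<le> x \<Longrightarrow> card (Z \<inter> {x..<x + Suc K}) \<le> K"
      by blast
    define k where "k = max N (Suc K)"
    have "{s k..<s k + Suc K} \<subseteq> {s k..<s k + k}"
      by (auto simp: k_def)
    then have "Z \<inter> {s k..<s k + Suc K} = {s k..<s k + Suc K}"
      unfolding Z_def by blast
    then show False using N[of "s k"] s(1)[of k] by (simp add: k_def)
  qed
  moreover have "finite (Z \<inter> X j)" for j
  proof (rule finite_subset)
    show "Z \<inter> X j \<subseteq> (\<Union>k<j. {s k..<s k + k})"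
    proof
      fix z assume z: "z \<in> Z \<inter> X j"
      then obtain k where k: "z \<in> {s k..<s k + k}" by (auto simp: Z_def)
      then have "k < j" using s(2)[of k] z by (meson IntE UN_I atMost_iff disjoint_iff not_le)
      then show "z \<in> (\<Union>k<j. {s k..<s k + k})" using k by blast
    qed
  qed simp
  ultimately show ?thesis by blast
qed

section \<open>Sums of two powers of two\<close>

definition two_power_column :: "nat \<Rightarrow> nat set" where
  "two_power_column j = {2 ^ n + 2 ^ j |n. j < n}"

text \<open>For \<open>n = n'\<close> the difference is \<open>2 ^ j' - 2 ^ j\<close> with \<open>j < j'\<close>. For \<open>n < n'\<close> it is at least
  \<open>2 ^ n - 2 ^ j\<close>, where \<open>2 ^ n\<close> is at least twice \<open>2 ^ j\<close>. If
  \<open>n' < n\<close>, then \<open>2 ^ n' + 2 ^ j'\<close> is less than \<open>2 ^ (n' + 1)\<close>, hence less than \<open>2 ^ n\<close>.\<close>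

lemma two_power_sum_gap:
  fixes n j n' j' :: nat
  assumes "j < n" "j' < n'" and less: "(2::nat) ^ n + 2 ^ j < 2 ^ n' + 2 ^ j'"
  shows "2 ^ j \<le> (2 ^ n' + 2 ^ j') - (2 ^ n + 2 ^ j :: nat)"
proof -
  have double: "2 * (2::nat) ^ a \<le> 2 ^ b" if "a < b" for a b :: nat
    using power_increasing[of "Suc a" b "2::nat"] that by simp
  consider "n < n'" | "n = n'" | "n' < n" by linarith
  then show ?thesis
  proof cases
    case 1
    then show ?thesis using double[of n n'] double[of j n] assms by linarith
  next
    case 2
    then have "j < j'" using less by simp
    then show ?thesis using double[of j j'] 2 by simp
  next
    case 3
    moreover have "0 < (2::nat) ^ n'" by simp
    ultimately have False using double[of n' n] double[of j' n'] assms by linarith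
    then show ?thesis ..
  qed
qed

lemma two_power_column_in_lacunary_ideal: "two_power_column j \<in> lacunary_ideal"
proof (rule lacunary_idealI_gap)
  fix m :: nat
  have "m < y - x"
    if x: "x \<in> two_power_column j" and y: "y \<in> two_power_column j"
      and large: "2 * 2 ^ m \<le> x" and less: "x < y" for x y
  proof -
    obtain n where n: "x = 2 ^ n + 2 ^ j" "j < n" using x by (auto simp: two_power_column_def)
    obtain n' where n': "y = 2 ^ n' + 2 ^ j" using y by (auto simp: two_power_column_def)
    have "n < n'" using less n n' by simp
    then have "2 * (2::nat) ^ n \<le> 2 ^ n'"
      using power_increasing[of "Suc n" n' "2::nat"] by simp
    moreover have "(2::nat) ^ j < 2 ^ n" using n by simp
    moreover have "m < 2 ^ m" by (rule less_exp)
    ultimately show ?thesis using large n n' by linarith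
  qed
  then show "\<exists>N. \<forall>x\<in>two_power_column j. \<forall>y\<in>two_power_column j. N \<le> x \<longrightarrow> x < y \<longrightarrow> m < y - x"
    by blast
qed

text \<open>Far out, such a set only has points from columns of large index \<open>j\<close>, and a point of column
  \<open>j\<close> is followed by a gap of at least \<open>2 ^ j\<close>.\<close>

lemma finite_in_columns_in_lacunary_ideal:
  assumes B: "B \<subseteq> (\<Union>j. two_power_column j)" and fin: "\<And>j. finite (B \<inter> two_power_column j)"
  shows "B \<in> lacunary_ideal"
proof (rule lacunary_idealI_gap)
  fix m :: nat
  have "finite (\<Union>j\<le>m. B \<inter> two_power_column j)" by (intro finite_UN_I fin) simp
  then obtain N where N: "\<forall>x\<in>(\<Union>j\<le>m. B \<inter> two_power_column j). x < N"
    unfolding finite_nat_set_iff_bounded ..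
  have "m < y - x" if x: "x \<in> B" and y: "y \<in> B" and "N \<le> x" "x < y" for x y
  proof -
    obtain j where j: "x \<in> two_power_column j" using B x by blast
    then obtain n where n: "x = 2 ^ n + 2 ^ j" "j < n"
      unfolding two_power_column_def by blast
    obtain j' where "y \<in> two_power_column j'" using B y by blast
    then obtain n' where n': "y = 2 ^ n' + 2 ^ j'" "j' < n'"
      unfolding two_power_column_def by blast
    have "m < j"
    proof (rule ccontr)
      assume "\<not> m < j"
      then have "x \<in> (\<Union>j\<le>m. B \<inter> two_power_column j)" using j x by (intro UN_I[of j]) auto
      then have "x < N" by (rule N[rule_format])
      then show False using \<open>N \<le> x\<close> by simp
    qed
    also have "j < 2 ^ j" by (rule less_exp)
    also have "2 ^ j \<le> y - x" using two_power_sum_gap[of j n j' n'] n n' \<open>x < y\<close> by simp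
    finally show ?thesis .
  qed
  then show "\<exists>N. \<forall>x\<in>B. \<forall>y\<in>B. N \<le> x \<longrightarrow> x < y \<longrightarrow> m < y - x" by blast
qed

lemma two_power_columns_positive: "(\<Union>j. two_power_column j) \<notin> lacunary_ideal"
proof
  let ?A = "\<Union>j. two_power_column j"
  assume "?A \<in> lacunary_ideal"
  then obtain K where "\<And>m. \<exists>N. \<forall>x\<ge>N. card (?A \<inter> {x..<x + m}) \<le> K"
    using lacunary_ideal_window_bound by blast
  then obtain N where N: "\<And>x. N \<le> x \<Longrightarrow> card (?A \<inter> {x..<x + Suc (2 ^ K)}) \<le> K"
    by blast
  define n where "n = Suc (max N K)"
  let ?S = "(\<lambda>j. 2 ^ n + 2 ^ j :: nat) ` {..K}"
  have "2 ^ n + 2 ^ j \<in> two_power_column j" if "j \<le> K" for j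
    unfolding two_power_column_def using that by (auto simp: n_def simp del: power_Suc)
  then have "?S \<subseteq> ?A \<inter> {2 ^ n..<2 ^ n + Suc (2 ^ K)}"
    by (auto simp: less_Suc_eq_le)
  then have "card ?S \<le> card (?A \<inter> {2 ^ n..<2 ^ n + Suc (2 ^ K)})"
    by (intro card_mono) auto
  moreover have "\<dots> \<le> K"
    using less_exp[of n] by (intro N) (simp add: n_def)
  moreover have "card ?S = Suc K"
    by (subst card_image) (auto simp: inj_on_def)
  ultimately show False by linarith
qed

section \<open>Failure of homogeneity\<close>

lemma restricted_lacunary_ideal_not_katetov_le:
  defines "A \<equiv> \<Union>j. two_power_column j"
  shows "\<not> katetov_le A (restrict_ideal lacunary_ideal A) UNIV lacunary_ideal"
proof
  assume "katetov_le A (restrict_ideal lacunary_ideal A) UNIV lacunary_ideal"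
  then obtain f where f: "\<And>x. f x \<in> A"
    and pre: "\<And>B. B \<in> restrict_ideal lacunary_ideal A \<Longrightarrow> f -` B \<in> lacunary_ideal"
    unfolding katetov_le_def by auto
  have pre': "f -` B \<in> lacunary_ideal" if "B \<in> lacunary_ideal" "B \<subseteq> A" for B
    using that by (intro pre) (auto simp: restrict_ideal_def)
  have "f -` two_power_column j \<in> lacunary_ideal" for j
    by (rule pre') (auto simp: A_def two_power_column_in_lacunary_ideal)
  then obtain Z where Z: "Z \<notin> lacunary_ideal" "\<And>j. finite (Z \<inter> f -` two_power_column j)"
    using positive_set_almost_avoiding[of "\<lambda>j. f -` two_power_column j"] by blast
  have "finite (f ` Z \<inter> two_power_column j)" for j
  proof -
    have "f ` Z \<inter> two_power_column j = f ` (Z \<inter> f -` two_power_column j)" by blast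
    then show ?thesis using Z(2) by simp
  qed
  then have "f ` Z \<in> lacunary_ideal"
    using f by (intro finite_in_columns_in_lacunary_ideal) (auto simp: A_def)
  then have "f -` (f ` Z) \<in> lacunary_ideal"
    using f by (intro pre') auto
  then have "Z \<in> lacunary_ideal"
    by (rule lacunary_ideal_subset[rotated]) blast
  then show False using Z(1) by contradiction
qed

lemma ideal_isomorphic_imp_katetov_le:
  assumes "ideal_isomorphic X I Y K" "I \<subseteq> Pow X"
  shows "katetov_le X I Y K"
proof -
  obtain f where "bij_betw f Y X" "\<And>B. B \<subseteq> X \<Longrightarrow> f -` B \<inter> Y \<in> K \<longleftrightarrow> B \<in> I"
    using assms(1) unfolding ideal_isomorphic_def by blast
  then have "f \<in> Y \<rightarrow> X" "\<forall>B\<in>I. f -` B \<inter> Y \<in> K"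
    using assms(2) by (auto dest: bij_betw_imp_funcset)
  then show ?thesis unfolding katetov_le_def by blast
qed

theorem proposition10p3:
  "\<not> katetov_homogeneous UNIV lacunary_ideal \<and> \<not> homogeneous UNIV lacunary_ideal"
proof -
  let ?A = "\<Union>j. two_power_column j"
  have pos: "?A \<in> positive_sets UNIV lacunary_ideal"
    using two_power_columns_positive by (simp add: positive_sets_def)
  have "restrict_ideal lacunary_ideal ?A \<subseteq> Pow ?A"
    by (auto simp: restrict_ideal_def)
  then have "\<not> ideal_isomorphic ?A (restrict_ideal lacunary_ideal ?A) UNIV lacunary_ideal"
    using ideal_isomorphic_imp_katetov_le restricted_lacunary_ideal_not_katetov_le by blast
  then show ?thesis
    using pos restricted_lacunary_ideal_not_katetov_le
    unfolding katetov_homogeneous_def homogeneous_def by blast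
qed

end
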